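(* Let $G=(V,E)$ be a $d$-regular simple undirected graph with $d\ge1$ and $n=|V|$, and let $k$ be an integer with $1\le k\le n$. Let $$\delta:=\frac{d^3(2d-1)^{3n-3}}{(n+1)^6(2d+1)^{3n}},$$ and let $f$ be the objective function defined in the context with interaction matrix $P^{(\delta)}$. Consider minimizing $f(\alpha)$ over all $\alpha\in[0,1]^N$ with $\alpha_0=1$ and $\sum_{i\in V}\alpha_i\le k$ (an $L_1$-budget of $k$ for changing the resistance parameters of agents in $V$, which are initially $0$). Then there is a set $T\subseteq V$ with $|T|=k$ such that the minimum is attained at the vector $\alpha$ with $\alpha_0=1$, $\alpha_i=1$ for $i\in T$, and $\alpha_j=0$ for $j\in V\setminus T$.
   Context: Let $N=V\cup\{0\}$, where $0\notin V$ is an extra agent. Let $C\in[0,1]^{N\times N}$ have $C_{ii}=0$ and $C_{ij}=\frac1n$ for $i\ne j$. Let $R\in[0,1]^{N\times N}$ have $R_{00}=1$, $R_{ij}=\frac1d$ if $\{i,j\}\in E$, and all other entries $0$. For $\delta\in(0,1)$ put $P^{(\delta)}:=(1-\delta)C+\delta R$. The innate opinions are $s\in[0,1]^N$ with $s_0=1$ and $s_i=0$ for $i\in V$; the initial resistance vector is $\widehat\alpha$ with $\widehat\alpha_0=1$ and $\widehat\alpha_i=0$ for $i\in V$. For $\alpha\in[0,1]^N$ with $\alpha_0=1$ and $A=\mathrm{Diag}(\alpha)$, the objective function is $f(\alpha)=\mathbf 1^\top[I-(I-A)P^{(\delta)}]^{-1}As$ (the inverse exists), where $\mathbf 1$ is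 the all-ones vector. *)

theory Defs
  imports "HOL-Analysis.Analysis"
begin

text \<open>
  The vertex set \<open>V\<close> is the universe of a finite type \<^typ>\<open>'v\<close>. The agent set
  \<open>N = V \<union> {0}\<close> is \<^typ>\<open>'v option\<close>: the extra agent \<open>0\<close> is \<^term>\<open>None\<close>
  and \<open>i \<in> V\<close> is \<^term>\<open>Some i\<close>. Edges are sets of vertices.
\<close>

definition simple_graph :: "'v set set \<Rightarrow> bool" where
  "simple_graph E \<longleftrightarrow> (\<forall>e\<in>E. card e = 2)"

definition regular_graph :: "nat \<Rightarrow> 'v set set \<Rightarrow> bool" where
  "regular_graph d E \<longleftrightarrow> simple_graph E \<and> (\<forall>v. card {e \<in> E. v \<in> e} = d)"

definition C_mat :: "real ^ 'v option ^ ('v::finite) option" where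
  "C_mat = (\<chi> i j. if i = j then 0 else 1 / real CARD('v))"

definition R_mat :: "nat \<Rightarrow> 'v set set \<Rightarrow> real ^ 'v option ^ ('v::finite) option" where
  "R_mat d E = (\<chi> i j. case (i, j) of
       (None, None) \<Rightarrow> 1
     | (Some u, Some v) \<Rightarrow> (if {u, v} \<in> E then 1 / real d else 0)
     | _ \<Rightarrow> 0)"

definition P_mat :: "nat \<Rightarrow> 'v set set \<Rightarrow> real \<Rightarrow> real ^ 'v option ^ ('v::finite) option" where
  "P_mat d E \<delta> = (1 - \<delta>) *\<^sub>R C_mat + \<delta> *\<^sub>R R_mat d E"

definition innate :: "real ^ ('v::finite) option" where
  "innate = (\<chi> i. if i = None then 1 else 0)"

definition Diag :: "real ^ 'a \<Rightarrow> real ^ 'a ^ ('a::finite)" where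
  "Diag \<alpha> = (\<chi> i j. if i = j then \<alpha> $ i else 0)"

text \<open>
  The identity matrix is \<^term>\<open>mat 1\<close>; the vector \<open>1\<close> in the inner product is
  the all-ones vector.
\<close>

definition objective ::
  "real ^ 'a ^ 'a \<Rightarrow> real ^ 'a \<Rightarrow> real ^ ('a::finite) \<Rightarrow> real" where
  "objective P s \<alpha> =
     1 \<bullet> ((matrix_inv (mat 1 - (mat 1 - Diag \<alpha>) ** P) ** Diag \<alpha>) *v s)"

text \<open>
  The agents in \<open>V\<close> have initial resistance \<open>0\<close>, so the \<open>L\<^sub>1\<close> cost of changing
  their resistances to \<open>\<alpha>\<close> is the sum of the entries of \<open>\<alpha>\<close> over \<open>V\<close>.
\<close>

definition feasible :: "nat \<Rightarrow> (real ^ ('v::finite) option) set" where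
  "feasible k = {\<alpha>. (\<forall>i. 0 \<le> \<alpha> $ i \<and> \<alpha> $ i \<le> 1) \<and> \<alpha> $ None = 1 \<and>
                    (\<Sum>i\<in>UNIV. \<alpha> $ Some i) \<le> real k}"

definition resistance_of :: "'v set \<Rightarrow> real ^ ('v::finite) option" where
  "resistance_of T = (\<chi> i. case i of None \<Rightarrow> 1 | Some v \<Rightarrow> (if v \<in> T then 1 else 0))"

end

theory Submission
  imports Defs
begin

text \<open>
  Put \<open>\<beta> = 1 - \<alpha>\<close> on \<open>V\<close> and \<open>c = (1 - \<delta>) / n\<close>. The expressed opinions are \<open>\<beta> v\<close>, where
  \<open>v = c + M (\<beta> v)\<close> and \<open>M = c (J - I) + \<delta> Q\<close> (\<open>J\<close> all ones, \<open>Q\<close> the normalised adjacency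
  matrix), and the objective is \<open>1 + S\<close> with \<open>S = \<Sum> \<beta> v\<close>. Because \<open>M\<close> is symmetric, two
  parameter vectors satisfy \<open>c (S' - S) = \<Sum> (\<beta>' - \<beta>) v v'\<close>. Hence \<open>S\<close> is increasing in
  \<open>\<beta>\<close>. It also follows that if \<open>v\<^sub>i \<le> v\<^sub>j\<close> and resistance \<open>t\<close> is moved from \<open>i\<close> to \<open>j\<close>, then \<open>S\<close>
  can only grow if \<open>v'\<^sub>i > v'\<^sub>j\<close>. But up to terms of order \<open>\<delta>\<close> the difference \<open>v\<^sub>i - v\<^sub>j\<close>
  is \<open>- c (x\<^sub>i - x\<^sub>j)\<close> with \<open>x = \<beta> v\<close>, and so decreases under the move. Thus a pair of
  fractional resistances can always be shifted until one of them is \<open>0\<close> or \<open>1\<close>.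
\<close>

section \<open>Rounding fractional points of a box under an integral budget\<close>

definition unit_box :: "('v \<Rightarrow> real) set" where
  "unit_box = {a. \<forall>i. 0 \<le> a i \<and> a i \<le> 1}"

lemma unit_boxD: "a \<in> unit_box \<Longrightarrow> 0 \<le> a i" "a \<in> unit_box \<Longrightarrow> a i \<le> 1"
  by (auto simp: unit_box_def)

lemma exists_card_superset:
  fixes A :: "'v::finite set"
  assumes "card A \<le> k" "k \<le> CARD('v)"
  shows "\<exists>T. A \<subseteq> T \<and> card T = k"
  using exists_subset_between[of A k UNIV] assms by auto

lemma sum_indicator_UNIV: "(\<Sum>j\<in>UNIV. indicator T j) = real (card (T :: 'v::finite set))"
  by (simp add: indicator_def)

lemma sum_transfer:
  fixes a :: "'v::finite \<Rightarrow> real"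
  assumes "i \<noteq> j"
  shows "sum (a(i := a i - t, j := a j + t)) UNIV = sum a UNIV"
proof -
  have "a(i := a i - t, j := a j + t)
      = (\<lambda>l. a l + (if l = j then t else 0) - (if l = i then t else 0))"
    using assms by auto
  then show ?thesis by (simp add: sum.distrib sum_subtractf)
qed

text \<open>Induction on the number of fractional coordinates. One of them is raised to 1 if the
  budget allows; otherwise a second one exists and \<open>swap\<close> moves mass between the two
  until one becomes integral. An integral point is the indicator of at most \<open>k\<close>
  elements and is padded to exactly \<open>k\<close> by \<open>mono\<close>.\<close>

lemma box_rounding:
  fixes F :: "('v::finite \<Rightarrow> real) \<Rightarrow> real"
  assumes mono: "\<And>a b. a \<in> unit_box \<Longrightarrow> b \<in> unit_box \<Longrightarrow> (\<And>i. a i \<le> b i) \<Longrightarrow> F b \<le> F a"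
    and swap: "\<And>a i j. a \<in> unit_box \<Longrightarrow> i \<noteq> j \<Longrightarrow>
      (\<forall>t\<ge>0. a(i := a i - t, j := a j + t) \<in> unit_box \<longrightarrow> F (a(i := a i - t, j := a j + t)) \<le> F a) \<or>
      (\<forall>t\<ge>0. a(j := a j - t, i := a i + t) \<in> unit_box \<longrightarrow> F (a(j := a j - t, i := a i + t)) \<le> F a)"
    and k: "k \<le> CARD('v)"
  shows "a \<in> unit_box \<Longrightarrow> sum a UNIV \<le> real k \<Longrightarrow> \<exists>T. card T = k \<and> F (indicator T) \<le> F a"
proof (induction "card {i. a i \<noteq> 0 \<and> a i \<noteq> 1}" arbitrary: a rule: less_induct)
  case less
  let ?fr = "\<lambda>a :: 'v \<Rightarrow> real. {i. a i \<noteq> 0 \<and> a i \<noteq> 1}"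
  note box = unit_boxD[OF less.prems(1)]
  have descend: ?case
    if b: "F b \<le> F a" "b \<in> unit_box" "sum b UNIV \<le> real k" "?fr b \<subset> ?fr a" for b
  proof -
    have "card (?fr b) < card (?fr a)" using b(4) by (simp add: psubset_card_mono)
    then obtain T where "card T = k" "F (indicator T) \<le> F b"
      using less.hyps b(2,3) by blast
    with b(1) show ?thesis by (blast intro: order_trans)
  qed
  show ?case
  proof (cases "?fr a = {}")
    case True
    define A where "A = {i. a i = 1}"
    have a: "a = indicator A" using True by (auto simp: A_def indicator_def fun_eq_iff)
    have "card A \<le> k" using less.prems(2) unfolding a by (simp add: sum_indicator_UNIV)
    then obtain T where T: "A \<subseteq> T" "card T = k" using exists_card_superset k by blast
    have "F (indicator T) \<le> F a"
      using T(1) by (intro mono) (auto simp: a unit_box_def indicator_def)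
    with T show ?thesis by blast
  next
    case False
    then obtain i where i: "i \<in> ?fr a" by auto
    then have ai: "0 < a i" "a i < 1" using box[of i] by auto
    have upd: "sum (a(i := 1)) UNIV = sum a UNIV - a i + 1"
      by (simp add: sum.remove[of UNIV i])
    show ?thesis
    proof (cases "sum a UNIV - a i + 1 \<le> real k")
      case True
      show ?thesis
      proof (rule descend)
        show "F (a(i := 1)) \<le> F a" using box by (intro mono) (auto simp: unit_box_def)
        show "a(i := 1) \<in> unit_box" using box by (auto simp: unit_box_def)
        show "sum (a(i := 1)) UNIV \<le> real k" using upd True by simp
        show "?fr (a(i := 1)) \<subset> ?fr a" using i by auto
      qed
    next
      case False
      \<comment> \<open>With \<open>i\<close> as the only fractional coordinate the sum would be an
        integer plus \<open>a i\<close>. Since \<open>a i\<close> is positive and \<open>k\<close>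
        is an integer, the budget would then have room to raise \<open>a i\<close> to 1.\<close>
      have "\<exists>j. j \<noteq> i \<and> j \<in> ?fr a"
      proof (rule ccontr)
        assume "\<nexists>j. j \<noteq> i \<and> j \<in> ?fr a"
        then have "\<And>l. l \<noteq> i \<Longrightarrow> a l = 0 \<or> a l = 1" by blast
        then have "sum a UNIV = (\<Sum>l\<in>UNIV. indicator {l. l \<noteq> i \<and> a l = 1} l + (if l = i then a i else 0))"
          by (intro sum.cong) (auto simp: indicator_def)
        also have "\<dots> = real (card {l. l \<noteq> i \<and> a l = 1}) + a i"
          by (simp only: sum.distrib sum_indicator_UNIV) simp
        finally have sum_a: "sum a UNIV = \<dots>" .
        then have "card {l. l \<noteq> i \<and> a l = 1} < k" using less.prems(2) ai by linarith
        then have "real (card {l. l \<noteq> i \<and> a l = 1}) + 1 \<le> real k" by linarith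
        then show False using False sum_a by linarith
      qed
      then obtain j where j: "j \<noteq> i" "j \<in> ?fr a" by auto
      have shift: ?thesis
        if pq: "p \<noteq> q" "p \<in> ?fr a" "q \<in> ?fr a"
          and le: "\<forall>t\<ge>0. a(p := a p - t, q := a q + t) \<in> unit_box \<longrightarrow>
            F (a(p := a p - t, q := a q + t)) \<le> F a" for p q
      proof -
        \<comment> \<open>The largest shift that stays in the box: it sends \<open>a p\<close> to 0
          or \<open>a q\<close> to 1.\<close>
        define t where "t = min (a p) (1 - a q)"
        let ?b = "a(p := a p - t, q := a q + t)"
        have t: "0 \<le> t" "t \<le> a p" "t \<le> 1 - a q" using box[of p] box[of q] by (auto simp: t_def)
        have b: "?b \<in> unit_box"
          using box t by (fastforce simp: unit_box_def intro: order_trans[of _ "a p"])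
        show ?thesis
        proof (rule descend[OF _ b])
          show "F ?b \<le> F a" using le t b by blast
          show "sum ?b UNIV \<le> real k" using sum_transfer[OF pq(1)] less.prems(2) by metis
          have "p \<notin> ?fr ?b \<or> q \<notin> ?fr ?b" using pq(1) by (auto simp: t_def min_def)
          then show "?fr ?b \<subset> ?fr a" using pq by (auto split: if_splits)
        qed
      qed
      from swap[OF less.prems(1) j(1)[symmetric]] show ?thesis
        using shift[of i j] shift[of j i] i j by blast
    qed
  qed
qed

section \<open>Equilibria on a slightly perturbed complete graph\<close>

lemma abs_weighted_sum_le:
  assumes "\<And>j. 0 \<le> (w :: 'v::finite \<Rightarrow> real) j" "\<And>j. \<bar>x j\<bar> \<le> B"
  shows "\<bar>\<Sum>j\<in>UNIV. w j * x j\<bar> \<le> sum w UNIV * B"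
proof -
  have "\<bar>\<Sum>j\<in>UNIV. w j * x j\<bar> \<le> (\<Sum>j\<in>UNIV. \<bar>w j * x j\<bar>)" by (rule sum_abs)
  also have "\<dots> \<le> (\<Sum>j\<in>UNIV. w j * B)"
    using assms by (intro sum_mono) (simp add: abs_mult mult_left_mono)
  finally show ?thesis by (simp add: sum_distrib_right)
qed

text \<open>The graph enters only through a symmetric stochastic \<open>Q\<close>. The relation
  \<open>c_\<delta>\<close> makes the rows of \<open>M\<close> sum to \<open>1 - c\<close>, so
  \<open>M\<close> contracts the maximum norm by that factor.\<close>

locale perturbed_clique =
  fixes Q :: "'v::finite \<Rightarrow> 'v \<Rightarrow> real" and c \<delta> :: real
  assumes Q_sym: "Q i j = Q j i"
    and Q_nonneg: "0 \<le> Q i j"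
    and Q_row: "(\<Sum>j\<in>UNIV. Q i j) = 1"
    and c_pos: "0 < c" and \<delta>_nonneg: "0 \<le> \<delta>"
    and c_\<delta>: "c * real CARD('v) + \<delta> = 1"
begin

definition M :: "'v \<Rightarrow> 'v \<Rightarrow> real" where
  "M i j = (if i = j then 0 else c) + \<delta> * Q i j"

text \<open>The unknowns are the opinions before damping by \<open>b\<close>: unlike the expressed
  opinions \<open>b j * v j\<close>, they stay positive where \<open>b\<close> vanishes.\<close>

definition equilibrium :: "('v \<Rightarrow> real) \<Rightarrow> ('v \<Rightarrow> real) \<Rightarrow> bool" where
  "equilibrium b v \<longleftrightarrow> (\<forall>i. v i = c + (\<Sum>j\<in>UNIV. M i j * (b j * v j)))"

lemma equilibriumD: "equilibrium b v \<Longrightarrow> v i = c + (\<Sum>j\<in>UNIV. M i j * (b j * v j))"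
  unfolding equilibrium_def by blast

lemma M_sym: "M i j = M j i"
  by (simp add: M_def Q_sym)

lemma M_nonneg: "0 \<le> M i j"
  unfolding M_def using c_pos \<delta>_nonneg Q_nonneg
  by (intro add_nonneg_nonneg mult_nonneg_nonneg) auto

lemma M_apply: "(\<Sum>j\<in>UNIV. M i j * x j) = c * (sum x UNIV - x i) + \<delta> * (\<Sum>j\<in>UNIV. Q i j * x j)"
proof -
  have "M i j * x j = (c * x j - (if i = j then c * x j else 0)) + \<delta> * (Q i j * x j)" for j
    by (simp add: M_def algebra_simps)
  then show ?thesis
    by (simp add: sum.distrib sum_subtractf sum_distrib_left right_diff_distrib)
qed

lemma M_row: "(\<Sum>j\<in>UNIV. M i j) = 1 - c"
  using M_apply[of i "\<lambda>_. 1"] c_\<delta> Q_row by (simp add: algebra_simps)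

lemma c_le_1: "c \<le> 1"
proof -
  have "0 \<le> (\<Sum>j\<in>UNIV. M undefined j)" by (intro sum_nonneg M_nonneg)
  then show ?thesis by (simp add: M_row)
qed

text \<open>Maximum principle: at an index where the modulus of \<open>w\<close> attains its maximum
  \<open>m\<close>, the equation gives \<open>m \<le> B + (1 - c) * m\<close>. With
  \<open>B = 0\<close> this yields uniqueness, later used to invert the resolvent matrix.\<close>

lemma fixpoint_bound:
  assumes b: "b \<in> unit_box"
    and w: "\<And>i. w i = r i + (\<Sum>j\<in>UNIV. M i j * (b j * w j))"
    and r: "\<And>i. \<bar>r i\<bar> \<le> B"
  shows "c * \<bar>w i\<bar> \<le> B"
proof -
  define m where "m = Max (range (\<lambda>i. \<bar>w i\<bar>))"
  have m: "\<bar>w j\<bar> \<le> m" for j by (auto simp: m_def)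
  have "m \<in> range (\<lambda>i. \<bar>w i\<bar>)" unfolding m_def by (intro Max_in) auto
  then obtain l where l: "m = \<bar>w l\<bar>" by auto
  have bw: "\<bar>b j * w j\<bar> \<le> m" for j
    using mult_mono[OF unit_boxD(2)[OF b, of j] m[of j]] unit_boxD(1)[OF b, of j]
    by (simp add: abs_mult)
  have "\<bar>\<Sum>j\<in>UNIV. M l j * (b j * w j)\<bar> \<le> (1 - c) * m"
    using abs_weighted_sum_le[of "M l" "\<lambda>j. b j * w j" m] bw M_nonneg by (simp add: M_row)
  then have "m \<le> B + (1 - c) * m" using w[of l] r[of l] l by linarith
  then have "c * m \<le> B" by (simp add: algebra_simps)
  with mult_left_mono[OF m[of i], of c] c_pos show ?thesis by linarith
qed

lemma equilibrium_le_1: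
  assumes "b \<in> unit_box" "equilibrium b v"
  shows "v i \<le> 1"
proof -
  have "c * \<bar>v i\<bar> \<le> c"
    using assms c_pos by (intro fixpoint_bound[of b v "\<lambda>_. c"] equilibriumD) auto
  then show ?thesis using c_pos by simp
qed

text \<open>Minimum principle: a negative minimum \<open>m\<close> satisfies
  \<open>m \<le> b j * m\<close>, hence \<open>c + (1 - c) * m \<le> m\<close>, which forces
  \<open>m \<ge> 1\<close>. Once \<open>v\<close> is nonnegative, its equation gives the bound
  \<open>c\<close>.\<close>

lemma equilibrium_ge_c:
  assumes b: "b \<in> unit_box" and v: "equilibrium b v"
  shows "c \<le> v i"
proof -
  define m where "m = Min (range v)"
  have m: "m \<le> v j" for j by (auto simp: m_def)
  have "m \<in> range v" unfolding m_def by (intro Min_in) auto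
  then obtain l where l: "m = v l" by auto
  have "0 \<le> m"
  proof (rule ccontr)
    assume "\<not> 0 \<le> m"
    then have "m \<le> b j * m" "b j * m \<le> b j * v j" for j
      using m[of j] unit_boxD[OF b, of j] mult_right_mono_neg[of "b j" 1 m]
      by (auto intro: mult_left_mono)
    then have "m \<le> b j * v j" for j by (rule order_trans)
    then have "(\<Sum>j\<in>UNIV. M l j * m) \<le> (\<Sum>j\<in>UNIV. M l j * (b j * v j))"
      by (intro sum_mono mult_left_mono M_nonneg)
    then have "c + (1 - c) * m \<le> m"
      using equilibriumD[OF v, of l] l by (simp add: M_row flip: sum_distrib_right)
    then have "c * (1 - m) \<le> 0" by (simp add: algebra_simps)
    with \<open>\<not> 0 \<le> m\<close> c_pos show False by (simp add: mult_le_0_iff)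
  qed
  then have "0 \<le> (\<Sum>j\<in>UNIV. M i j * (b j * v j))"
    using m unit_boxD[OF b] by (intro sum_nonneg mult_nonneg_nonneg M_nonneg) (auto intro: order_trans)
  then show ?thesis using equilibriumD[OF v, of i] by linarith
qed

lemma equilibrium_pos:
  "b \<in> unit_box \<Longrightarrow> equilibrium b v \<Longrightarrow> 0 < v i"
  using equilibrium_ge_c c_pos by (meson less_le_trans)

text \<open>Each equation is solved for \<open>c\<close> and tested against the expressed opinions
  of the other equilibrium; by symmetry of \<open>M\<close> the two double sums cancel.\<close>

lemma total_difference:
  assumes v: "equilibrium b v" and v': "equilibrium b' v'"
  shows "c * ((\<Sum>i\<in>UNIV. b' i * v' i) - (\<Sum>i\<in>UNIV. b i * v i))
    = (\<Sum>i\<in>UNIV. (b' i - b i) * v i * v' i)"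
proof -
  let ?x = "\<lambda>i. b i * v i" and ?x' = "\<lambda>i. b' i * v' i"
  have c: "c = v i - (\<Sum>j\<in>UNIV. M i j * ?x j)" "c = v' i - (\<Sum>j\<in>UNIV. M i j * ?x' j)" for i
    using equilibriumD[OF v, of i] equilibriumD[OF v', of i] by simp_all
  have "c * sum ?x' UNIV = (\<Sum>i\<in>UNIV. (v i - (\<Sum>j\<in>UNIV. M i j * ?x j)) * ?x' i)"
    using c(1) by (simp add: sum_distrib_left)
  also have "\<dots> = (\<Sum>i\<in>UNIV. v i * ?x' i) - (\<Sum>i\<in>UNIV. \<Sum>j\<in>UNIV. M i j * ?x j * ?x' i)"
    by (simp add: left_diff_distrib sum_subtractf sum_distrib_right)
  finally have 1: "c * sum ?x' UNIV = \<dots>" .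
  have "c * sum ?x UNIV = (\<Sum>i\<in>UNIV. (v' i - (\<Sum>j\<in>UNIV. M i j * ?x' j)) * ?x i)"
    using c(2) by (simp add: sum_distrib_left)
  also have "\<dots> = (\<Sum>i\<in>UNIV. v' i * ?x i) - (\<Sum>i\<in>UNIV. \<Sum>j\<in>UNIV. M i j * ?x' j * ?x i)"
    by (simp add: left_diff_distrib sum_subtractf sum_distrib_right)
  also have "(\<Sum>i\<in>UNIV. \<Sum>j\<in>UNIV. M i j * ?x' j * ?x i) = (\<Sum>i\<in>UNIV. \<Sum>j\<in>UNIV. M i j * ?x j * ?x' i)"
    by (subst sum.swap) (simp add: M_sym mult_ac)
  finally have "c * (sum ?x' UNIV - sum ?x UNIV) = (\<Sum>i\<in>UNIV. v i * ?x' i) - (\<Sum>i\<in>UNIV. v' i * ?x i)"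
    using 1 by (simp add: right_diff_distrib)
  then show ?thesis by (simp add: algebra_simps flip: sum_subtractf)
qed

lemma total_mono:
  assumes "b \<in> unit_box" "equilibrium b v" "b' \<in> unit_box" "equilibrium b' v'" "\<And>i. b i \<le> b' i"
  shows "(\<Sum>i\<in>UNIV. b i * v i) \<le> (\<Sum>i\<in>UNIV. b' i * v' i)"
proof -
  have "0 \<le> (\<Sum>i\<in>UNIV. (b' i - b i) * v i * v' i)"
    using assms equilibrium_pos[OF assms(1,2)] equilibrium_pos[OF assms(3,4)]
    by (intro sum_nonneg mult_nonneg_nonneg) (auto simp: less_imp_le)
  then show ?thesis
    using c_pos by (simp add: zero_le_mult_iff flip: total_difference[OF assms(2,4)])
qed

text \<open>If the total grew, \<open>total_difference\<close> and \<open>v i \<le> v j\<close>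
  would force \<open>v' j < v' i\<close>, so \<open>w j < w i\<close>. By \<open>w_eq\<close> this
  keeps \<open>D i - D j\<close> below a term of order \<open>\<delta>\<close>, whereas the transfer
  itself pushes \<open>D i - D j\<close> above roughly \<open>t * c / (1 + c)\<close>.\<close>

lemma transfer_decreases:
  assumes small: "6 * \<delta> \<le> c ^ 3"
    and b: "b \<in> unit_box" and v: "equilibrium b v"
    and b': "b' \<in> unit_box" and v': "equilibrium b' v'"
    and b'_def: "b' = b(i := b i + t, j := b j - t)" and ij: "i \<noteq> j" and t: "0 \<le> t"
    and le: "v i \<le> v j"
  shows "(\<Sum>l\<in>UNIV. b' l * v' l) \<le> (\<Sum>l\<in>UNIV. b l * v l)"
proof (rule ccontr)
  define D where "D = (\<lambda>l. b' l * v' l - b l * v l)"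
  define w where "w = (\<lambda>l. v' l - v l)"
  define A where "A = (\<lambda>l. \<Sum>j\<in>UNIV. Q l j * D j)"
  define s where "s = c * sum D UNIV"
  assume "\<not> ?thesis"
  then have s_pos: "0 < s" using c_pos by (simp add: s_def D_def sum_subtractf)
  note v1 = equilibrium_le_1[OF b v] and v'1 = equilibrium_le_1[OF b' v']
    and v0 = equilibrium_pos[OF b v] and v'0 = equilibrium_pos[OF b' v']
    and v'c = equilibrium_ge_c[OF b' v']
  have diff: "b' l - b l = (if l = i then t else 0) - (if l = j then t else 0)" for l
    using ij by (simp add: b'_def)
  have "s = (\<Sum>l\<in>UNIV. (b' l - b l) * v l * v' l)"
    using total_difference[OF v v'] by (simp add: s_def D_def sum_subtractf)
  also have "\<dots> = (\<Sum>l\<in>UNIV. (if l = i then t * v l * v' l else 0) - (if l = j then t * v l * v' l else 0))"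
    unfolding diff by (intro sum.cong) auto
  finally have s: "s = t * (v i * v' i) - t * (v j * v' j)" by (simp add: sum_subtractf mult_ac)
  then have t_pos: "0 < t" using s_pos t by (cases "t = 0") auto
  have "v j * v' j < v i * v' i" using s s_pos t_pos by simp
  moreover have "v i * v' j \<le> v j * v' j" using le v'0[of j] by (intro mult_right_mono) auto
  ultimately have "v i * v' j < v i * v' i" by simp
  then have v'_less: "v' j < v' i" using v0[of i] by simp
  have w_D: "w l = (\<Sum>m\<in>UNIV. M l m * D m)" for l
    unfolding w_def D_def
    using equilibriumD[OF v, of l] equilibriumD[OF v', of l]
    by (simp add: right_diff_distrib sum_subtractf)
  have w_eq: "w l = s - c * D l + \<delta> * A l" for l
    using M_apply[of l D] w_D[of l] by (simp add: s_def A_def algebra_simps)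
  have D_eq: "D l = (b' l - b l) * v' l + b l * w l" for l
    by (simp add: D_def w_def algebra_simps)
  have src: "\<bar>(b' l - b l) * v' l\<bar> \<le> t" for l
    using t v'0[of l] v'1[of l] mult_left_mono[of "v' l" 1 t] by (auto simp: diff abs_mult)
  \<comment> \<open>\<open>D\<close> is a source of size at most \<open>t\<close> plus
    \<open>b l * w l\<close>. The equation for \<open>w\<close> has \<open>M\<close> applied to that
    source as its inhomogeneity, so \<open>c * \<bar>w l\<bar> \<le> (1 - c) * t\<close>, and adding
    \<open>c * t\<close> leaves \<open>t\<close>.\<close>
  have D_bound: "\<bar>D l\<bar> \<le> t / c" for l
  proof -
    have "c * \<bar>w l\<bar> \<le> (1 - c) * t"
    proof (rule fixpoint_bound[OF b])
      show "w m = (\<Sum>l\<in>UNIV. M m l * ((b' l - b l) * v' l)) + (\<Sum>l\<in>UNIV. M m l * (b l * w l))" for m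
        unfolding w_D[of m] by (subst D_eq) (simp add: distrib_left sum.distrib)
      show "\<bar>\<Sum>l\<in>UNIV. M m l * ((b' l - b l) * v' l)\<bar> \<le> (1 - c) * t" for m
        using abs_weighted_sum_le[of "M m" "\<lambda>l. (b' l - b l) * v' l" t] src M_nonneg
        by (simp add: M_row)
    qed
    moreover have "\<bar>b l * w l\<bar> \<le> \<bar>w l\<bar>"
      using unit_boxD[OF b, of l] mult_right_mono[of "b l" 1 "\<bar>w l\<bar>"] by (simp add: abs_mult)
    then have "\<bar>D l\<bar> \<le> t + \<bar>w l\<bar>" using src[of l] unfolding D_eq[of l] by linarith
    then have "c * \<bar>D l\<bar> \<le> c * t + c * \<bar>w l\<bar>"
      using c_pos by (simp flip: distrib_left)
    ultimately have "c * \<bar>D l\<bar> \<le> t" by (simp add: algebra_simps)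
    then show ?thesis using c_pos by (simp add: field_simps)
  qed
  \<comment> \<open>A uniform bound on the contribution of \<open>Q\<close> to each
    \<open>w l\<close>.\<close>
  define e where "e = \<delta> * (t / c)"
  have e0: "0 \<le> e" using \<delta>_nonneg t c_pos by (simp add: e_def)
  have A_bound: "\<bar>\<delta> * A l\<bar> \<le> e" for l
  proof -
    have "\<bar>A l\<bar> \<le> t / c"
      using abs_weighted_sum_le[of "Q l" D "t / c"] D_bound Q_nonneg by (simp add: A_def Q_row)
    from mult_left_mono[OF this \<delta>_nonneg] show ?thesis
      using \<delta>_nonneg by (simp add: e_def abs_mult)
  qed
  have bA: "\<bar>b l * (\<delta> * A l)\<bar> \<le> e" for l
    using mult_mono[OF unit_boxD(2)[OF b, of l] A_bound[of l]] unit_boxD(1)[OF b, of l]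
    by (simp add: abs_mult)
  have bl: "0 \<le> b l" "b l \<le> 1" for l using unit_boxD[OF b] by auto
  have cb: "0 \<le> c * b l" "c * b l \<le> c" for l
    using bl[of l] c_pos by (auto intro: mult_left_le)
  have Di: "D i * (1 + c * b i) = b i * s + b i * (\<delta> * A i) + t * v' i"
    using D_eq[of i] w_eq[of i] ij by (simp add: diff algebra_simps)
  have Dj: "D j * (1 + c * b j) = b j * s + b j * (\<delta> * A j) - t * v' j"
    using D_eq[of j] w_eq[of j] ij by (simp add: diff algebra_simps)
  \<comment> \<open>The constant 6 covers the error \<open>2 * e + 4 * (c * e)\<close> collected at
    the end.\<close>
  have e_small: "6 * e \<le> t * c * c"
  proof -
    have "6 * e = 6 * \<delta> * (t / c)" by (simp add: e_def)
    also have "\<dots> \<le> c ^ 3 * (t / c)" using small t c_pos by (intro mult_right_mono) auto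
    also have "\<dots> = t * c * c" using c_pos by (simp add: power3_eq_cube)
    finally show ?thesis .
  qed
  have tcc: "t * c * c \<le> t * c" using c_le_1 t c_pos by (simp add: mult_left_le)
  have tc: "t * c \<le> t * v' l" for l using v'c[of l] t by (simp add: mult_left_mono)
  \<comment> \<open>The sign of \<open>D i\<close> is settled first, since enlarging the factor
    \<open>1 + c * b i\<close> to \<open>1 + c\<close> needs \<open>D i\<close> nonnegative.\<close>
  have lower: "t * v' i - e \<le> D i * (1 + c)"
  proof -
    have "0 \<le> b i * s" using bl s_pos by simp
    then have 1: "t * v' i - e \<le> D i * (1 + c * b i)"
      using Di bA[of i] by linarith
    moreover have "0 \<le> t * v' i - e" using e_small e0 tcc tc[of i] by linarith
    ultimately have "0 \<le> D i * (1 + c * b i)" by linarith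
    then have "0 \<le> D i" using cb[of i] by (simp add: zero_le_mult_iff)
    then have "D i * (1 + c * b i) \<le> D i * (1 + c)" using cb[of i] by (intro mult_left_mono) auto
    with 1 show ?thesis by linarith
  qed
  \<comment> \<open>The sign of \<open>D j\<close> is open, so the estimate is multiplied by
    \<open>1 + c\<close> and the positive factor \<open>1 + c * b j\<close> is cancelled
    afterwards.\<close>
  have upper: "D j * (1 + c) \<le> s + e - t * v' j"
  proof -
    have neg: "0 \<le> t * v' j - e" using e_small e0 tcc tc[of j] by linarith
    have "D j * (1 + c * b j) \<le> b j * s - (t * v' j - e)" using Dj bA[of j] by linarith
    then have "D j * (1 + c * b j) * (1 + c) \<le> (b j * s - (t * v' j - e)) * (1 + c)"
      using c_pos by (intro mult_right_mono) auto
    also have "\<dots> = (b j + c * b j) * s - (t * v' j - e) * (1 + c)" by (simp add: algebra_simps)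
    also have "\<dots> \<le> (1 + c * b j) * s - (t * v' j - e) * (1 + c * b j)"
      using bl[of j] cb[of j] s_pos neg by (intro diff_mono mult_right_mono mult_left_mono) auto
    also have "\<dots> = (1 + c * b j) * (s + e - t * v' j)" by (simp add: algebra_simps)
    finally have "(1 + c * b j) * (D j * (1 + c)) \<le> (1 + c * b j) * (s + e - t * v' j)"
      by (simp add: mult_ac)
    then show ?thesis using cb[of j] by (simp add: mult_le_cancel_left)
  qed
  \<comment> \<open>The bound \<open>s \<le> t * v' i\<close> lets the lower estimate for
    \<open>D i\<close> absorb the \<open>s\<close> in the upper estimate for \<open>D j\<close>;
    what remains is \<open>t * v' j\<close>, at least \<open>t * c\<close>.\<close>
  have "t * (v i * v' i) \<le> t * v' i"
    using v1[of i] v'0[of i] t by (intro mult_left_mono) (auto simp: mult_left_le_one_le v0 less_imp_le)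
  moreover have "0 \<le> t * (v j * v' j)" using t v0[of j] v'0[of j] by simp
  ultimately have "s \<le> t * v' i" using s by linarith
  then have "t * c - 2 * e \<le> (D i - D j) * (1 + c)"
    using lower upper tc[of j] by (simp add: algebra_simps)
  then have "c * (t * c - 2 * e) \<le> (c * (D i - D j)) * (1 + c)"
    using c_pos by (simp add: mult.assoc)
  also have "\<dots> < (2 * e) * (1 + c)"
  proof (intro mult_strict_right_mono)
    have "0 < w i - w j" using v'_less le by (simp add: w_def)
    then have "c * (D i - D j) < \<delta> * A i - \<delta> * A j" using w_eq[of i] w_eq[of j] by (simp add: algebra_simps)
    also have "\<dots> \<le> 2 * e" using A_bound[of i] A_bound[of j] by linarith
    finally show "c * (D i - D j) < 2 * e" .
  qed (use c_pos in simp)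
  finally have "t * c * c < 2 * e + 4 * (c * e)" by (simp add: algebra_simps)
  moreover have "c * e \<le> e" using c_le_1 e0 c_pos by (simp add: mult_left_le_one_le)
  ultimately show False using e_small by linarith
qed

text \<open>Passing to \<open>1 - a\<close> reverses order, so \<open>total_mono\<close> makes
  \<open>F\<close> antitone. Of two agents, resistance may be moved away from the one with smaller
  \<open>v\<close>, which supplies the disjunction in \<open>box_rounding\<close>.\<close>

lemma rounding:
  assumes small: "6 * \<delta> \<le> c ^ 3"
    and F: "\<And>a. a \<in> unit_box \<Longrightarrow> \<exists>v. equilibrium (\<lambda>i. 1 - a i) v \<and> F a = (\<Sum>i\<in>UNIV. (1 - a i) * v i)"
    and k: "k \<le> CARD('v)" and a: "a \<in> unit_box" "sum a UNIV \<le> real k"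
  shows "\<exists>T. card T = k \<and> F (indicator T) \<le> F a"
proof (rule box_rounding[OF _ _ k a])
  have compl: "(\<lambda>i. 1 - a i) \<in> unit_box" if "a \<in> unit_box" for a :: "'v \<Rightarrow> real"
    using that by (auto simp: unit_box_def)
  show "F b \<le> F a" if "a \<in> unit_box" "b \<in> unit_box" "\<And>i. a i \<le> b i" for a b
  proof -
    obtain v w where "equilibrium (\<lambda>i. 1 - a i) v" "F a = (\<Sum>i\<in>UNIV. (1 - a i) * v i)"
      "equilibrium (\<lambda>i. 1 - b i) w" "F b = (\<Sum>i\<in>UNIV. (1 - b i) * w i)"
      using F \<open>a \<in> unit_box\<close> \<open>b \<in> unit_box\<close> by metis
    then show ?thesis
      using total_mono[of "\<lambda>i. 1 - b i" w "\<lambda>i. 1 - a i" v] compl that by simp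
  qed
  fix a :: "'v \<Rightarrow> real" and i j :: 'v
  assume a: "a \<in> unit_box" and ij: "i \<noteq> j"
  obtain v where v: "equilibrium (\<lambda>i. 1 - a i) v" "F a = (\<Sum>i\<in>UNIV. (1 - a i) * v i)"
    using F[OF a] by blast
  have step: "F (a(p := a p - t, q := a q + t)) \<le> F a"
    if "v p \<le> v q" "p \<noteq> q" "0 \<le> t" and b: "a(p := a p - t, q := a q + t) \<in> unit_box" for p q t
  proof -
    let ?b = "a(p := a p - t, q := a q + t)"
    obtain w where "equilibrium (\<lambda>i. 1 - ?b i) w" "F ?b = (\<Sum>i\<in>UNIV. (1 - ?b i) * w i)"
      using F[OF b] by blast
    moreover have "(\<lambda>i. 1 - ?b i) = (\<lambda>i. 1 - a i)(p := 1 - a p + t, q := 1 - a q - t)"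
      by (auto simp: fun_eq_iff)
    ultimately show ?thesis
      using transfer_decreases[OF small compl[OF a] v(1) compl[OF b], of w p t q] that v(2)
      by simp
  qed
  show "(\<forall>t\<ge>0. a(i := a i - t, j := a j + t) \<in> unit_box \<longrightarrow> F (a(i := a i - t, j := a j + t)) \<le> F a) \<or>
      (\<forall>t\<ge>0. a(j := a j - t, i := a i + t) \<in> unit_box \<longrightarrow> F (a(j := a j - t, i := a i + t)) \<le> F a)"
    using step[of i j] step[of j i] ij by (cases "v i \<le> v j") auto
qed

end

section \<open>Resolvent matrices, graph degrees and the size of \<open>\<delta>\<close>\<close>

lemma sum_option:
  fixes g :: "'v::finite option \<Rightarrow> 'b::comm_monoid_add"
  shows "sum g UNIV = g None + (\<Sum>i\<in>UNIV. g (Some i))"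
  by (simp add: UNIV_option_conv sum.reindex)

lemma Diag_mult_vec: "(Diag a *v x) $ i = a $ i * x $ i"
  by (simp add: Diag_def matrix_vector_mult_def if_distrib[where f = "\<lambda>u. u * _"] cong: if_cong)

lemma resolvent_mult_vec:
  "((mat 1 - (mat 1 - Diag a) ** P) *v z) $ i = z $ i - (1 - a $ i) * (P *v z) $ i"
  by (simp add: Diag_mult_vec algebra_simps
      flip: matrix_vector_mul_assoc)

text \<open>\<open>matrix_inv\<close> is a choice operator, so an inverse has to exist first; for a
  square matrix a trivial kernel provides it.\<close>

lemma matrix_inv_right_inverse:
  fixes A :: "real ^ 'a ^ ('a::finite)"
  assumes "\<And>z. A *v z = 0 \<Longrightarrow> z = 0"
  shows "A ** matrix_inv A = mat 1"
proof -
  have "invertible A"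
    using assms matrix_left_invertible_ker[of A] invertible_left_inverse[of A] by blast
  then have "\<exists>B. A ** B = mat 1 \<and> B ** A = mat 1"
    by (simp add: invertible_def)
  then show ?thesis
    unfolding matrix_inv_def by (rule someI2_ex) simp
qed

text \<open>Regularity counts incident edges, the rows of \<open>R_mat\<close> count neighbours;
  sending \<open>j\<close> to \<open>{i, j}\<close> matches the two.\<close>

lemma regular_graph_neighbours:
  assumes "regular_graph d E"
  shows "card {j. {i, j} \<in> E} = d"
proof -
  have two: "card e = 2" if "e \<in> E" for e
    using assms that by (auto simp: regular_graph_def simple_graph_def)
  have "bij_betw (\<lambda>j. {i, j}) {j. {i, j} \<in> E} {e \<in> E. i \<in> e}"
  proof (rule bij_betwI')
    fix e assume e: "e \<in> {e \<in> E. i \<in> e}"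
    then obtain j where "e = {i, j}"
      using two[of e] by (auto simp: card_2_iff)
    with e show "\<exists>j\<in>{j. {i, j} \<in> E}. e = {i, j}" by auto
  qed (auto simp: doubleton_eq_iff)
  then show ?thesis
    using assms by (auto simp: regular_graph_def dest: bij_betw_same_card)
qed

text \<open>The 8 turns \<open>d ^ 3\<close> into \<open>(2 * d) ^ 3\<close>; then every factor of
  the numerator is at most \<open>2 * d + 1\<close>.\<close>

lemma \<delta>_bound:
  fixes d n :: nat
  assumes "d \<ge> 1" "n \<ge> 1"
    and \<delta>: "\<delta> = real d ^ 3 * (2 * real d - 1) ^ (3 * n - 3)
             / ((real n + 1) ^ 6 * (2 * real d + 1) ^ (3 * n))"
  shows "0 \<le> \<delta>" "8 * \<delta> * (real n + 1) ^ 6 \<le> 1"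
proof -
  show "0 \<le> \<delta>" using assms by simp
  have e: "3 * n = 3 + (3 * n - 3)" using assms(2) by simp
  have "8 * real d ^ 3 * (2 * real d - 1) ^ (3 * n - 3) = (2 * real d) ^ 3 * (2 * real d - 1) ^ (3 * n - 3)"
    by (simp add: power_mult_distrib)
  also have "\<dots> \<le> (2 * real d + 1) ^ 3 * (2 * real d + 1) ^ (3 * n - 3)"
    using assms(1) by (intro mult_mono power_mono) auto
  also have "\<dots> = (2 * real d + 1) ^ (3 * n)" by (subst e) (simp only: power_add)
  finally have "8 * (real d ^ 3 * (2 * real d - 1) ^ (3 * n - 3)) / (2 * real d + 1) ^ (3 * n) \<le> 1"
    using assms(1) by (simp add: mult.assoc)
  moreover have "(real n + 1) ^ 6 \<noteq> 0" by simp
  ultimately show "8 * \<delta> * (real n + 1) ^ 6 \<le> 1"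
    by (simp add: \<delta>)
qed

lemma \<delta>_small:
  fixes n :: nat
  assumes n: "n \<ge> 1" and "0 \<le> \<delta>" "8 * \<delta> * (real n + 1) ^ 6 \<le> 1"
  shows "\<delta> < 1" "6 * \<delta> \<le> ((1 - \<delta>) / real n) ^ 3"
proof -
  let ?N = "real n + 1"
  have N: "8 \<le> ?N ^ 3" using n power_mono[of 2 ?N 3] by simp
  have N6: "?N ^ 6 = ?N ^ 3 * ?N ^ 3" by (simp flip: power_add)
  have "8 * ?N ^ 3 \<le> ?N ^ 6" unfolding N6 using N by (intro mult_right_mono) auto
  then have "8 * \<delta> * (8 * ?N ^ 3) \<le> 8 * \<delta> * ?N ^ 6" using assms by (intro mult_left_mono) auto
  then have *: "64 * \<delta> * ?N ^ 3 \<le> 1" using assms(3) by (simp add: mult_ac)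
  have "64 * \<delta> * 8 \<le> 64 * \<delta> * ?N ^ 3" using N assms(2) by (intro mult_left_mono) auto
  then have d: "\<delta> \<le> 1 / 2" using * by simp
  then show "\<delta> < 1" by simp
  have "real n ^ 3 \<le> ?N ^ 3" by (intro power_mono) auto
  then have "64 * \<delta> * real n ^ 3 \<le> 64 * \<delta> * ?N ^ 3" using assms(2) by (intro mult_left_mono) auto
  \<comment> \<open>Here 48 is 6 times \<open>2 ^ 3\<close>, matching
    \<open>1 - \<delta> \<ge> 1 / 2\<close> cubed.\<close>
  then have "48 * \<delta> * real n ^ 3 \<le> 1" using * assms(2) mult_nonneg_nonneg[of \<delta> "real n ^ 3"] by linarith
  then have "6 * \<delta> * real n ^ 3 \<le> (1 / 2) ^ 3" by (simp add: power3_eq_cube)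
  also have "\<dots> \<le> (1 - \<delta>) ^ 3" using d by (intro power_mono) auto
  finally show "6 * \<delta> \<le> ((1 - \<delta>) / real n) ^ 3"
    using n by (simp add: power_divide pos_le_divide_eq)
qed

section \<open>The graph instance and the minimum over sets of size \<open>k\<close>\<close>

theorem lemma3p5:
  fixes E :: "('v::finite) set set" and d n k :: nat and \<delta> :: real
    and f :: "real ^ 'v option \<Rightarrow> real"
  assumes "regular_graph d E" and "d \<ge> 1" and "n = CARD('v)"
    and "1 \<le> k" and "k \<le> n"
    and "\<delta> = real d ^ 3 * (2 * real d - 1) ^ (3 * n - 3)
             / ((real n + 1) ^ 6 * (2 * real d + 1) ^ (3 * n))"
    and "f = objective (P_mat d E \<delta>) innate"
  shows "\<exists>T :: 'v set. card T = k \<and> resistance_of T \<in> feasible k \<and>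
           (\<forall>\<alpha> \<in> feasible k. f (resistance_of T) \<le> f \<alpha>)"
proof -
  define Q where "Q = (\<lambda>i j :: 'v. if {i, j} \<in> E then 1 / real d else 0)"
  define c where "c = (1 - \<delta>) / real n"
  have n: "n \<ge> 1" using assms(4,5) by simp
  note \<delta>b = \<delta>_bound[OF assms(2) n assms(6)]
  note \<delta>s = \<delta>_small[OF n \<delta>b]
  interpret perturbed_clique Q c \<delta>
  proof
    show "Q i j = Q j i" for i j by (simp add: Q_def insert_commute)
    show "0 \<le> Q i j" for i j by (simp add: Q_def)
    show "(\<Sum>j\<in>UNIV. Q i j) = 1" for i
      using regular_graph_neighbours[OF assms(1), of i] assms(2)
      by (simp add: Q_def sum.If_cases)
    show "0 < c" using \<delta>s n by (simp add: c_def)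
    show "0 \<le> \<delta>" by fact
    show "c * real CARD('v) + \<delta> = 1" using n assms(3) by (simp add: c_def)
  qed
  let ?P = "P_mat d E \<delta> :: real ^ 'v option ^ 'v option"
  define vec where "vec = (\<lambda>a :: 'v \<Rightarrow> real. \<chi> i. case i of None \<Rightarrow> 1 | Some v \<Rightarrow> a v)"
  have P: "(?P *v z) $ Some i = c * z $ None + (\<Sum>j\<in>UNIV. M i j * z $ Some j)" for z i
  proof -
    have "?P $ Some i $ None = c" "?P $ Some i $ Some j = M i j" for j
      unfolding M_def using assms(3) by (simp_all add: P_mat_def C_mat_def R_mat_def c_def Q_def)
    then show ?thesis by (simp add: matrix_vector_mult_def sum_option)
  qed
  \<comment> \<open>The 1 taken off is the opinion of agent 0 itself.\<close>
  have F: "\<exists>v. equilibrium (\<lambda>i. 1 - a i) v \<and> f (vec a) - 1 = (\<Sum>i\<in>UNIV. (1 - a i) * v i)"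
    if a: "a \<in> unit_box" for a
  proof -
    let ?A = "mat 1 - (mat 1 - Diag (vec a)) ** ?P"
    have None: "(?A *v z) $ None = z $ None" for z
      by (simp add: resolvent_mult_vec vec_def)
    have Some: "(?A *v z) $ Some i = z $ Some i - (1 - a i) * (?P *v z) $ Some i" for z i
      by (simp add: resolvent_mult_vec vec_def)
    \<comment> \<open>A kernel vector vanishes at agent 0, and its averages \<open>w\<close> solve
      the homogeneous fixpoint equation, so \<open>fixpoint_bound\<close> with bound 0 kills
      them.\<close>
    have "?A ** matrix_inv ?A = mat 1"
    proof (rule matrix_inv_right_inverse)
      fix z assume z: "?A *v z = 0"
      have z0: "z $ None = 0" using None[of z] z by simp
      define w where "w = (\<lambda>i. (?P *v z) $ Some i)"
      have zS: "z $ Some i = (1 - a i) * w i" for i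
        using Some[of z i] z by (simp add: w_def)
      have "w i = (\<Sum>j\<in>UNIV. M i j * z $ Some j)" for i by (simp add: w_def P z0)
      then have w: "w i = 0 + (\<Sum>j\<in>UNIV. M i j * ((1 - a j) * w j))" for i unfolding zS add_0 .
      have "(\<lambda>i. 1 - a i) \<in> unit_box" using a by (auto simp: unit_box_def)
      from fixpoint_bound[OF this w] have "c * \<bar>w i\<bar> \<le> 0" for i by simp
      then have "w i = 0" for i using c_pos by (simp add: mult_le_0_iff)
      then have "z $ Some i = 0" for i by (simp add: zS)
      with z0 show "z = 0" by (metis option.exhaust vec_eq_iff zero_index)
    qed
    moreover define z where "z = (matrix_inv ?A ** Diag (vec a)) *v innate"
    ultimately have "?A *v z = Diag (vec a) *v innate"
      by (simp add: matrix_vector_mul_assoc matrix_mul_assoc)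
    then have Az: "(?A *v z) $ i = vec a $ i * innate $ i" for i by (simp add: Diag_mult_vec)
    have z0: "z $ None = 1" using Az[of None] by (simp only: None) (simp add: vec_def innate_def)
    define v where "v = (\<lambda>i. (?P *v z) $ Some i)"
    have zS: "z $ Some i = (1 - a i) * v i" for i
      using Az[of "Some i"] by (simp only: Some) (simp add: innate_def v_def)
    have "v i = c + (\<Sum>j\<in>UNIV. M i j * z $ Some j)" for i by (simp add: v_def P z0)
    then have "equilibrium (\<lambda>i. 1 - a i) v" unfolding equilibrium_def zS by blast
    moreover have "f (vec a) = 1 + (\<Sum>i\<in>UNIV. (1 - a i) * v i)"
      unfolding assms(7) objective_def z_def[symmetric]
      by (simp add: inner_vec_def sum_option z0 zS)
    ultimately show ?thesis by auto
  qed
  have vec_T: "vec (indicator T) = resistance_of T" for T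
    by (simp add: vec_def resistance_of_def vec_eq_iff indicator_def split: option.split)
  have round: "\<exists>T. card T = k \<and> f (resistance_of T) \<le> f \<alpha>" if \<alpha>: "\<alpha> \<in> feasible k" for \<alpha>
  proof -
    let ?a = "\<lambda>i. \<alpha> $ Some i"
    have "vec ?a = \<alpha>" using \<alpha> by (auto simp: vec_def feasible_def vec_eq_iff split: option.split)
    moreover have "\<exists>T. card T = k \<and> f (vec (indicator T)) - 1 \<le> f (vec ?a) - 1"
      using \<alpha> assms(3,5) \<delta>s(2) by (intro rounding F) (auto simp: c_def feasible_def unit_box_def)
    ultimately show ?thesis by (simp add: vec_T)
  qed
  have feas: "resistance_of T \<in> feasible k" if "card T = k" for T :: "'v set"
    using that by (auto simp: feasible_def resistance_of_def sum.If_cases split: option.split)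
  \<comment> \<open>A best \<open>T\<close> exists among the finitely many sets of size
    \<open>k\<close>; \<open>round\<close> compares every feasible point with one of these.\<close>
  have "{T :: 'v set. card T = k} \<noteq> {}"
    using exists_card_superset[of "{} :: 'v set" k] assms(3,5) by auto
  then have "\<exists>T. is_arg_min (\<lambda>T. f (resistance_of T)) (\<lambda>T. T \<in> {T :: 'v set. card T = k}) T"
    by (intro ex_is_arg_min_if_finite) auto
  then obtain T :: "'v set" where T: "card T = k"
    "\<And>T'. card T' = k \<Longrightarrow> f (resistance_of T) \<le> f (resistance_of T')"
    unfolding is_arg_min_linorder by blast
  have "f (resistance_of T) \<le> f \<alpha>" if "\<alpha> \<in> feasible k" for \<alpha>
    using round[OF that] T(2) by (blast intro: order_trans)
  then show ?thesis using T(1) feas by blast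
qed

end
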